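(* (a) Let $c:\mathbb{R}\to\mathbb{R}^n$ be a smooth curve that is affinely invariant under the mapping $T$. Assume in addition that for some $t_0\in\mathbb{R}$ the vectors $\dot c(t_0),\ddot c(t_0),\ldots,c^{(n)}(t_0)$ are linearly independent. Then there is a unique matrix $B\in M(n;\mathbb{R})$ and a unique vector $d\in\mathbb{R}^n$ such that $\ddot c(t)=Bc(t)+d$ for all $t\in\mathbb{R}$. (b) Let $B\in M(n;\mathbb{R})$ be a real matrix and $d\in\mathbb{R}^n$ a vector. Then any solution $c:\mathbb{R}\to\mathbb{R}^n$ of the inhomogeneous linear differential equation $\ddot c(t)=Bc(t)+d$ is a smooth curve that is affinely invariant under the mapping $T$.
   Context: $M(n;\mathbb{R})$ is the space of real $n\times n$ matrices. A smooth curve $c:\mathbb{R}\to\mathbb{R}^n$ is called affinely invariant under the mapping $T$ (or a soliton of the curve shortening process $T$) if there is some $\epsilon>0$ and a one-parameter family $s\in(-\epsilon,\epsilon)\mapsto (A(s),b(s))\in GL(n,\mathbb{R})\times\mathbb{R}^n$ such that $$c_s(t):=\tfrac14\{c(t-s)+2c(t)+c(t+s)\}=A(s)c(t)+b(s)$$ for all $s\in(0,\epsilon)$ and all $t\in\mathbb{R}$. (The name comes from the map $T$ on polygons $(x_j)_{j\in\mathbb{Z}}$ in $\mathbb{R}^n$ given by $T(x)_j=\frac14\{x_{j-1}+2x_j+x_{j+1}\}$.) *)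

theory Defs
  imports "HOL-Analysis.Analysis"
begin

definition iter_vderiv :: "nat \<Rightarrow> (real \<Rightarrow> 'a::real_normed_vector) \<Rightarrow> real \<Rightarrow> 'a" where
  "iter_vderiv k c = ((\<lambda>f t. vector_derivative f (at t)) ^^ k) c"

(* vector_derivative is a Hilbert choice where the derivative does not exist, so
   differentiability at every order has to be demanded explicitly. *)
definition smooth_curve :: "(real \<Rightarrow> 'a::real_normed_vector) \<Rightarrow> bool" where
  "smooth_curve c \<longleftrightarrow> (\<forall>k t. iter_vderiv k c differentiable (at t))"

(* On the polygon j \<mapsto> c (t + j s) this is the map T x j = (x (j - 1) + 2 x j + x (j + 1)) / 4. *)
definition T_curve :: "real \<Rightarrow> (real \<Rightarrow> 'a::real_vector) \<Rightarrow> real \<Rightarrow> 'a" where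
  "T_curve s c t = (1/4) *\<^sub>R (c (t - s) + 2 *\<^sub>R c t + c (t + s))"

(* No regularity of A and b in s is required. Smoothness of c is kept separate. *)
definition affinely_invariant :: "(real \<Rightarrow> real^'n) \<Rightarrow> bool" where
  "affinely_invariant c \<longleftrightarrow>
     (\<exists>\<epsilon>>0. \<exists>(A :: real \<Rightarrow> real^'n^'n) (b :: real \<Rightarrow> real^'n).
        (\<forall>s\<in>{-\<epsilon><..<\<epsilon>}. invertible (A s)) \<and>
        (\<forall>s\<in>{0<..<\<epsilon>}. \<forall>t. T_curve s c t = A s *v c t + b s))"

(* Linear independence of an indexed family: the set notion alone would ignore repeated vectors. *)
definition independent_family_on :: "'i set \<Rightarrow> ('i \<Rightarrow> 'a::real_vector) \<Rightarrow> bool" where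
  "independent_family_on I v \<longleftrightarrow> inj_on v I \<and> independent (v ` I)"

(* Classical solutions, defined on the whole real line. *)
definition solves_ode2 :: "real^'n^'n \<Rightarrow> real^'n \<Rightarrow> (real \<Rightarrow> real^'n) \<Rightarrow> bool" where
  "solves_ode2 B d c \<longleftrightarrow>
     (\<forall>t. c differentiable (at t)) \<and>
     (\<forall>t. ((\<lambda>u. vector_derivative c (at u)) has_vector_derivative (B *v c t + d)) (at t))"

end

theory Submission
  imports Defs
begin

text \<open>
  Subtracting \<open>c t\<close> from the average defining \<open>T_curve\<close> turns affine invariance into a statement about second
  differences:
  \<open>c (t + s) + c (t - s) - 2 c t = 4 (A s - 1) c t + 4 b s\<close>, and after division by \<open>s\<^sup>2\<close> the left side
  tends to the second derivative of \<open>c\<close> at \<open>t\<close>.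

  From invariance to the equation. No regularity of \<open>A\<close> and \<open>b\<close> in \<open>s\<close> is given, so the convergence of
  \<open>4 (A s - 1) / s\<^sup>2\<close> as \<open>s\<close> tends to \<open>0\<close> has to come from the curve. The vectors on which these
  matrices converge form a subspace. It contains all chords \<open>c u - c t\<close>, because there the unknown
  translation part cancels. A subspace containing all chords contains, being closed, the first
  derivatives, hence their chords, hence the second derivatives, and so on; independence of the
  derivatives of orders \<open>1, ..., n\<close> at one point makes it the whole space
  (\<open>subspace_containing_chords_is_UNIV\<close>). The limits of the matrices and then of the translations are
  \<open>B\<close> and \<open>d\<close>. The same lemma, applied to the subspace on which two candidate matrices agree, gives
  uniqueness.

  From the equation to invariance. For fixed \<open>t\<close> the second difference
  \<open>f s = c (t + s) + c (t - s) - 2 c t\<close> solves \<open>f'' = B f + 2 (B (c t) + d)\<close> and vanishes to first order at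
  \<open>0\<close>. Hence \<open>f s = S s (2 (B (c t) + d))\<close> with the linear operator
  \<open>S s = (\<Sum>k. s\<^bsup>2k+2\<^esup> / (2k+2)! B\<^bsup>k\<^esup>)\<close> (\<open>cosh_tail\<close>,
  \<open>ode2_zero_initial_value_solution\<close>). This is affine in \<open>c t\<close> and gives
  \<open>A s = 1 + S s B / 2\<close> and \<open>b s = S s d / 2\<close>; since \<open>S s\<close> is of order \<open>s\<^sup>2\<close>, the matrix \<open>A s\<close> is
  invertible for small \<open>s\<close>.

  Both limits rest on one estimate: a bound on a second derivative, integrated twice from \<open>0\<close>
  (\<open>norm_le_power_of_second_derivative_bound\<close>).
\<close>

section \<open>Integrating a derivative bound\<close>

text \<open>The bound \<open>C x\<^sup>m / m!\<close> reproduces its own shape under integration, so that the lemma can be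
  iterated. The mean value inequality with a comparison function replaces the integral.\<close>

lemma norm_le_power_of_derivative_bound:
  fixes f f' :: "real \<Rightarrow> 'a::real_normed_vector"
  assumes deriv: "\<And>x. (f has_vector_derivative f' x) (at x)"
    and zero: "f 0 = 0"
    and bound: "\<And>x. 0 \<le> x \<Longrightarrow> x \<le> a \<Longrightarrow> norm (f' x) \<le> C * x ^ m / fact m"
    and s: "0 \<le> s" "s \<le> a"
  shows "norm (f s) \<le> C * s ^ Suc m / fact (Suc m)"
proof (cases "s = 0")
  case True
  then show ?thesis by (simp add: zero)
next
  case False
  let ?\<phi> = "\<lambda>x. C * x ^ Suc m / fact (Suc m)"
  have cf: "continuous_on {0..s} f"
    by (rule continuous_on_vector_derivative)
      (use deriv has_vector_derivative_at_within in blast)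
  have d\<phi>: "(?\<phi> has_vector_derivative C * x ^ m / fact m) (at x)" for x
    unfolding has_real_derivative_iff_has_vector_derivative[symmetric]
    by (rule derivative_eq_intros refl | simp add: field_simps del: of_nat_Suc)+
  have c\<phi>: "continuous_on {0..s} ?\<phi>"
    by (intro continuous_intros) simp
  have "norm (f s - f 0) \<le> ?\<phi> s - ?\<phi> 0"
    by (rule differentiable_bound_general[OF _ cf c\<phi>])
      (use False s deriv d\<phi> bound in auto)
  then show ?thesis by (simp add: zero)
qed

lemma norm_le_power_of_second_derivative_bound:
  fixes f f' f'' :: "real \<Rightarrow> 'a::real_normed_vector"
  assumes "\<And>x. (f has_vector_derivative f' x) (at x)"
    and "\<And>x. (f' has_vector_derivative f'' x) (at x)"
    and "f 0 = 0" "f' 0 = 0"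
    and "\<And>x. 0 \<le> x \<Longrightarrow> x \<le> a \<Longrightarrow> norm (f'' x) \<le> C * x ^ m / fact m"
    and "0 \<le> s" "s \<le> a"
  shows "norm (f s) \<le> C * s ^ (m + 2) / fact (m + 2)"
proof -
  have "norm (f' x) \<le> C * x ^ Suc m / fact (Suc m)" if "0 \<le> x" "x \<le> a" for x
    by (rule norm_le_power_of_derivative_bound[OF assms(2,4,5) that])
  from norm_le_power_of_derivative_bound[OF assms(1,3) this assms(6,7)]
  show ?thesis by simp
qed

section \<open>Second differences\<close>

lemma second_difference_has_vector_derivatives:
  fixes c :: "real \<Rightarrow> 'a::real_normed_vector"
  assumes "\<And>x. (c has_vector_derivative c' x) (at x)"
    and "\<And>x. (c' has_vector_derivative c'' x) (at x)"
  shows "((\<lambda>s. c (t + s) + c (t - s) - 2 *\<^sub>R c t)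
            has_vector_derivative c' (t + s) - c' (t - s)) (at s)"
    and "((\<lambda>s. c' (t + s) - c' (t - s)) has_vector_derivative c'' (t + s) + c'' (t - s)) (at s)"
proof -
  have plus: "((\<lambda>s. g (t + s)) has_vector_derivative g' (t + s)) (at s)"
    and minus: "((\<lambda>s. g (t - s)) has_vector_derivative - g' (t - s)) (at s)"
    if g: "\<And>x. (g has_vector_derivative g' x) (at x)" for g g' :: "real \<Rightarrow> 'a"
  proof -
    have "((\<lambda>s. t + s) has_vector_derivative 1) (at s)"
      by (auto intro!: derivative_eq_intros)
    from vector_diff_chain_at[OF this g]
    show "((\<lambda>s. g (t + s)) has_vector_derivative g' (t + s)) (at s)" by (simp add: o_def)
    have "((\<lambda>s. t - s) has_vector_derivative -1) (at s)"
      by (auto intro!: derivative_eq_intros)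
    from vector_diff_chain_at[OF this g]
    show "((\<lambda>s. g (t - s)) has_vector_derivative - g' (t - s)) (at s)" by (simp add: o_def)
  qed
  show "((\<lambda>s. c (t + s) + c (t - s) - 2 *\<^sub>R c t)
            has_vector_derivative c' (t + s) - c' (t - s)) (at s)"
    using has_vector_derivative_diff[OF has_vector_derivative_add[OF plus[OF assms(1)] minus[OF assms(1)]]
        has_vector_derivative_const[of "2 *\<^sub>R c t"]]
    by simp
  show "((\<lambda>s. c' (t + s) - c' (t - s)) has_vector_derivative c'' (t + s) + c'' (t - s)) (at s)"
    using has_vector_derivative_diff[OF plus[OF assms(2)] minus[OF assms(2)]] by simp
qed

text \<open>The error \<open>f s = c (t + s) + c (t - s) - 2 c t - s\<^sup>2 c'' t\<close> vanishes to first order at \<open>0\<close>, and its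
  second derivative is small near \<open>0\<close> by continuity of \<open>c''\<close>; integrating twice makes
  \<open>f s\<close> small compared with \<open>s\<^sup>2\<close>.\<close>

lemma second_difference_quotient_tendsto:
  fixes c :: "real \<Rightarrow> 'a::real_normed_vector"
  assumes c': "\<And>x. (c has_vector_derivative c' x) (at x)"
    and c'': "\<And>x. (c' has_vector_derivative c'' x) (at x)"
    and cont: "isCont c'' t"
  shows "((\<lambda>s. (1 / s\<^sup>2) *\<^sub>R (c (t + s) + c (t - s) - 2 *\<^sub>R c t)) \<longlongrightarrow> c'' t) (at_right 0)"
proof (rule tendstoI)
  fix e :: real assume e: "0 < e"
  then obtain \<delta> where \<delta>: "0 < \<delta>" "\<And>x. dist x t < \<delta> \<Longrightarrow> dist (c'' x) (c'' t) < e / 2"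
    using cont unfolding continuous_at_eps_delta by (meson half_gt_zero)
  let ?f = "\<lambda>s. c (t + s) + c (t - s) - 2 *\<^sub>R c t - (s\<^sup>2) *\<^sub>R c'' t"
  let ?f' = "\<lambda>s. c' (t + s) - c' (t - s) - (2 * s) *\<^sub>R c'' t"
  let ?f'' = "\<lambda>s. c'' (t + s) + c'' (t - s) - 2 *\<^sub>R c'' t"
  have sq: "((\<lambda>s. (s\<^sup>2) *\<^sub>R c'' t) has_vector_derivative (2 * s) *\<^sub>R c'' t) (at s)" for s
    by (auto intro!: derivative_eq_intros)
  have lin: "((\<lambda>s. (2 * s) *\<^sub>R c'' t) has_vector_derivative 2 *\<^sub>R c'' t) (at s)" for s
    by (auto intro!: derivative_eq_intros)
  have d1: "(?f has_vector_derivative ?f' s) (at s)" for s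
    by (rule has_vector_derivative_diff[OF second_difference_has_vector_derivatives(1)[OF c' c''] sq])
  have d2: "(?f' has_vector_derivative ?f'' s) (at s)" for s
    by (rule has_vector_derivative_diff[OF second_difference_has_vector_derivatives(2)[OF c' c''] lin])
  have b: "norm (?f'' x) \<le> e * x ^ 0 / fact 0" if "0 \<le> x" "x \<le> \<delta> / 2" for x
  proof -
    have "?f'' x = (c'' (t + x) - c'' t) + (c'' (t - x) - c'' t)" by (simp add: scaleR_2)
    also have "norm \<dots> \<le> dist (c'' (t + x)) (c'' t) + dist (c'' (t - x)) (c'' t)"
      unfolding dist_norm by (rule norm_triangle_ineq)
    also have "\<dots> < e / 2 + e / 2"
      by (intro add_strict_mono \<delta>(2)) (use that \<delta>(1) in \<open>auto simp: dist_real_def\<close>)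
    finally show ?thesis by simp
  qed
  have "dist ((1 / s\<^sup>2) *\<^sub>R (c (t + s) + c (t - s) - 2 *\<^sub>R c t)) (c'' t) < e"
    if s: "0 < s" "s < \<delta> / 2" for s
  proof -
    have "norm (?f s) \<le> e * s ^ (0 + 2) / fact (0 + 2)"
      by (rule norm_le_power_of_second_derivative_bound[OF d1 d2 _ _ b])
        (use s in \<open>auto simp: scaleR_2\<close>)
    then have le: "norm (?f s) \<le> s\<^sup>2 * (e / 2)" by (simp add: field_simps power2_eq_square)
    have "(1 / s\<^sup>2) *\<^sub>R (c (t + s) + c (t - s) - 2 *\<^sub>R c t) - c'' t = (1 / s\<^sup>2) *\<^sub>R ?f s"
      using s by (simp add: scaleR_diff_right)
    then have "dist ((1 / s\<^sup>2) *\<^sub>R (c (t + s) + c (t - s) - 2 *\<^sub>R c t)) (c'' t) = norm (?f s) / s\<^sup>2"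
      using s by (simp add: dist_norm)
    also have "\<dots> \<le> e / 2" using le s by (simp add: field_simps)
    finally show ?thesis using e by linarith
  qed
  then show "\<forall>\<^sub>F s in at_right 0. dist ((1 / s\<^sup>2) *\<^sub>R (c (t + s) + c (t - s) - 2 *\<^sub>R c t)) (c'' t) < e"
    unfolding eventually_at_right_field using \<delta>(1) by (intro exI[of _ "\<delta> / 2"]) auto
qed

section \<open>Curves with independent derivatives\<close>

lemma iter_vderiv_0: "iter_vderiv 0 c = c"
  by (simp add: iter_vderiv_def)

lemma iter_vderiv_Suc: "iter_vderiv (Suc k) c t = vector_derivative (iter_vderiv k c) (at t)"
  by (simp add: iter_vderiv_def)

lemma smooth_curve_has_vector_derivative:
  "smooth_curve c \<Longrightarrow> (iter_vderiv k c has_vector_derivative iter_vderiv (Suc k) c t) (at t)"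
  by (simp add: smooth_curve_def iter_vderiv_Suc vector_derivative_works)

text \<open>Finite-dimensional subspaces are closed, so limits of difference quotients stay inside.\<close>

lemma vector_derivative_in_subspace:
  fixes g :: "real \<Rightarrow> 'a::euclidean_space"
  assumes W: "subspace W" and g: "(g has_vector_derivative g') (at t)"
    and diff: "\<And>u. g u - g t \<in> W"
  shows "g' \<in> W"
proof -
  let ?q = "\<lambda>u. (1 / (u - t)) *\<^sub>R (g u - g t)"
  have "((\<lambda>u. norm (?q u - g')) \<longlongrightarrow> 0) (at t)"
  proof (rule Lim_transform_eventually)
    show "((\<lambda>u. norm (g u - g t - (u - t) *\<^sub>R g') / \<bar>u - t\<bar>) \<longlongrightarrow> 0) (at t)"
      using g by (simp add: has_vector_derivative_def has_derivative_iff_norm)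
    have "norm (g u - g t - (u - t) *\<^sub>R g') / \<bar>u - t\<bar> = norm (?q u - g')" if "u \<noteq> t" for u
    proof -
      have "?q u - g' = (1 / (u - t)) *\<^sub>R (g u - g t - (u - t) *\<^sub>R g')"
        using that by (simp add: scaleR_diff_right)
      then show ?thesis by (simp only: norm_scaleR) simp
    qed
    then show "\<forall>\<^sub>F u in at t. norm (g u - g t - (u - t) *\<^sub>R g') / \<bar>u - t\<bar> = norm (?q u - g')"
      by (simp add: eventually_at_filter)
  qed
  then have "(?q \<longlongrightarrow> g') (at t)"
    by (simp add: tendsto_norm_zero_iff LIM_zero_iff)
  moreover have "\<forall>\<^sub>F u in at t. (1 / (u - t)) *\<^sub>R (g u - g t) \<in> W"
    by (intro always_eventually allI subspace_scale[OF W] diff)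
  ultimately show ?thesis
    using Lim_in_closed_set[OF closed_subspace[OF W]] by (metis at_neq_bot)
qed

text \<open>If all values of the derivative of some order lie in \<open>W\<close>, then so do their differences, and the
  derivative of the next order lies in \<open>W\<close> as well. Thus \<open>W\<close> contains \<open>DIM('a)\<close> independent vectors.\<close>

lemma subspace_containing_chords_is_UNIV:
  fixes c :: "real \<Rightarrow> 'a::euclidean_space"
  assumes smooth: "smooth_curve c"
    and indep: "independent_family_on {1..DIM('a)} (\<lambda>k. iter_vderiv k c t\<^sub>0)"
    and W: "subspace W" and chords: "\<And>t u. c u - c t \<in> W"
  shows "W = UNIV"
proof -
  have deriv: "iter_vderiv (Suc k) c t \<in> W" for k t
  proof (induction k arbitrary: t)
    case 0
    show ?case
      by (rule vector_derivative_in_subspace[OF W smooth_curve_has_vector_derivative[OF smooth]])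
        (simp add: iter_vderiv_0 chords)
  next
    case (Suc k)
    show ?case
      by (rule vector_derivative_in_subspace[OF W smooth_curve_has_vector_derivative[OF smooth]])
        (intro subspace_diff[OF W] Suc)
  qed
  let ?D = "(\<lambda>k. iter_vderiv k c t\<^sub>0) ` {1..DIM('a)}"
  have "card ?D = DIM('a)"
    using indep by (simp add: independent_family_on_def card_image)
  then have "UNIV \<subseteq> span ?D"
    using indep by (intro card_ge_dim_independent) (auto simp: independent_family_on_def)
  moreover have "?D \<subseteq> W"
    using deriv by (force simp: image_iff elim: Suc_le_D[elim_format])
  ultimately show ?thesis using span_minimal[OF _ W] by blast
qed

section \<open>The differential equation of an affinely invariant curve\<close>

text \<open>The map \<open>v \<mapsto> L s v + e s\<close> below sends every point \<open>c t\<close> to the second difference quotient at \<open>t\<close>.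
  The quotients converge for each \<open>t\<close>; as the chords span the space, this forces \<open>L s\<close> to converge
  pointwise, and then \<open>e s\<close> to converge too.\<close>

lemma affinely_invariant_imp_ode2:
  fixes c :: "real \<Rightarrow> real^'n"
  assumes smooth: "smooth_curve c" and inv: "affinely_invariant c"
    and indep: "independent_family_on {1..CARD('n)} (\<lambda>k. iter_vderiv k c t\<^sub>0)"
  shows "\<exists>(B :: real^'n^'n) d. \<forall>t. iter_vderiv 2 c t = B *v c t + d"
proof -
  obtain \<epsilon> and A :: "real \<Rightarrow> real^'n^'n" and b where \<epsilon>: "\<epsilon> > 0"
    and T: "\<And>s t. 0 < s \<Longrightarrow> s < \<epsilon> \<Longrightarrow> T_curve s c t = A s *v c t + b s"
    using inv unfolding affinely_invariant_def by auto
  let ?c = "\<lambda>k. iter_vderiv k c"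
  let ?Q = "\<lambda>s t. (1 / s\<^sup>2) *\<^sub>R (c (t + s) + c (t - s) - 2 *\<^sub>R c t)"
  define L where "L s v = (4 / s\<^sup>2) *\<^sub>R (A s *v v - v)" for s v
  define e where "e s = (4 / s\<^sup>2) *\<^sub>R b s" for s
  have small: "\<forall>\<^sub>F s in at_right 0. 0 < s \<and> s < \<epsilon>"
    unfolding eventually_at_right_field using \<epsilon> by auto
  have L_affine: "?Q s t = L s (c t) + e s" if "0 < s" "s < \<epsilon>" for s t
  proof -
    have "c (t + s) + c (t - s) - 2 *\<^sub>R c t = 4 *\<^sub>R (T_curve s c t - c t)"
      by (simp add: T_curve_def vec_eq_iff field_simps)
    then have "?Q s t = (4 / s\<^sup>2) *\<^sub>R (T_curve s c t - c t)" by simp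
    also have "\<dots> = L s (c t) + e s"
      unfolding T[OF that] L_def e_def by (simp add: algebra_simps)
    finally show ?thesis .
  qed
  have Q_lim: "((\<lambda>s. ?Q s t) \<longlongrightarrow> iter_vderiv 2 c t) (at_right 0)" for t
  proof -
    have "isCont (iter_vderiv 2 c) t"
      by (rule has_vector_derivative_continuous[OF smooth_curve_has_vector_derivative[OF smooth]])
    moreover note smooth_curve_has_vector_derivative[OF smooth, of 0]
      smooth_curve_has_vector_derivative[OF smooth, of 1]
    ultimately show ?thesis
      using second_difference_quotient_tendsto[of c "iter_vderiv 1 c" "iter_vderiv 2 c" t]
      by (simp add: iter_vderiv_0 numeral_2_eq_2)
  qed
  have L_diff: "L s (u - v) = L s u - L s v"
    and L_add: "L s (u + v) = L s u + L s v"
    and L_scale: "L s (r *\<^sub>R v) = r *\<^sub>R L s v" for s r u v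
    by (simp_all add: L_def matrix_vector_mult_diff_distrib matrix_vector_right_distrib
        matrix_vector_mult_scaleR algebra_simps)
  define W where "W = {v. \<exists>l. ((\<lambda>s. L s v) \<longlongrightarrow> l) (at_right 0)}"
  have "W = UNIV"
  proof (rule subspace_containing_chords_is_UNIV[OF smooth])
    show "independent_family_on {1..DIM(real^'n)} (\<lambda>k. iter_vderiv k c t\<^sub>0)"
      using indep by simp
    show "subspace W"
      unfolding subspace_def W_def
    proof (intro conjI ballI allI)
      show "0 \<in> {v. \<exists>l. ((\<lambda>s. L s v) \<longlongrightarrow> l) (at_right 0)}"
        by (auto simp: L_def intro: tendsto_const)
    qed (auto simp: L_add L_scale intro: tendsto_add tendsto_scaleR[OF tendsto_const])
    show "c u - c t \<in> W" for t u
    proof -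
      have "\<forall>\<^sub>F s in at_right 0. ?Q s u - ?Q s t = L s (c u - c t)"
        using small by eventually_elim (simp only: L_affine L_diff add_diff_cancel_right)
      from tendsto_cong[OF this] tendsto_diff[OF Q_lim[of u] Q_lim[of t]]
      show ?thesis unfolding W_def by blast
    qed
  qed
  then have "\<forall>v. \<exists>l. ((\<lambda>s. L s v) \<longlongrightarrow> l) (at_right 0)" unfolding W_def by auto
  then obtain l where l: "\<And>v. ((\<lambda>s. L s v) \<longlongrightarrow> l v) (at_right 0)" by metis
  have lin: "linear l"
  proof (rule linearI)
    show "l (u + v) = l u + l v" for u v
      using tendsto_unique[OF _ l[of "u + v"]] tendsto_add[OF l[of u] l[of v]]
      by (simp add: L_add)
    show "l (r *\<^sub>R v) = r *\<^sub>R l v" for r v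
      using tendsto_unique[OF _ l[of "r *\<^sub>R v"]] tendsto_scaleR[OF tendsto_const l[of v]]
      by (simp add: L_scale)
  qed
  have e_lim: "(e \<longlongrightarrow> iter_vderiv 2 c t - l (c t)) (at_right 0)" for t
  proof -
    have "\<forall>\<^sub>F s in at_right 0. ?Q s t - L s (c t) = e s"
      using small by eventually_elim (simp only: L_affine add_diff_cancel_left')
    from tendsto_cong[OF this] tendsto_diff[OF Q_lim[of t] l[of "c t"]]
    show ?thesis by blast
  qed
  have "iter_vderiv 2 c t = matrix l *v c t + (iter_vderiv 2 c 0 - l (c 0))" for t
    using tendsto_unique[OF _ e_lim[of t] e_lim[of 0]] lin by (simp add: matrix_works algebra_simps)
  then show ?thesis by blast
qed

lemma ode2_coefficients_unique:
  fixes c :: "real \<Rightarrow> real^'n" and B B' :: "real^'n^'n"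
  assumes smooth: "smooth_curve c"
    and indep: "independent_family_on {1..CARD('n)} (\<lambda>k. iter_vderiv k c t\<^sub>0)"
    and eq: "\<And>t. B *v c t + d = B' *v c t + d'"
  shows "B = B' \<and> d = d'"
proof -
  let ?W = "{v. B *v v = B' *v v}"
  have "?W = UNIV"
  proof (rule subspace_containing_chords_is_UNIV[OF smooth])
    show "independent_family_on {1..DIM(real^'n)} (\<lambda>k. iter_vderiv k c t\<^sub>0)"
      using indep by simp
    show "subspace ?W"
      by (auto simp: subspace_def matrix_vector_right_distrib matrix_vector_mult_scaleR)
    show "c u - c t \<in> ?W" for t u
    proof -
      have "(B *v c u + d) - (B *v c t + d) = (B' *v c u + d') - (B' *v c t + d')"
        by (simp only: eq)
      then show ?thesis by (simp add: matrix_vector_mult_diff_distrib)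
    qed
  qed
  then have "B = B'" by (auto simp: matrix_eq set_eq_iff)
  with eq[of 0] show ?thesis by simp
qed

section \<open>Second-order linear equations\<close>

text \<open>Formally \<open>B\<^bsup>-1\<^esup> (cosh (s \<surd>B) - 1)\<close>. The series makes sense for singular \<open>B\<close> too, and as a function of
  \<open>s\<close> it is the solution of \<open>f'' = B f + v\<close> with zero initial values.\<close>

definition cosh_tail :: "('a::real_normed_vector \<Rightarrow> 'a) \<Rightarrow> real \<Rightarrow> 'a \<Rightarrow> 'a" where
  "cosh_tail B s v = (\<Sum>k. (s ^ (2 * k + 2) / fact (2 * k + 2)) *\<^sub>R (B ^^ k) v)"

lemma norm_funpow_le:
  fixes B :: "'a::real_normed_vector \<Rightarrow> 'a"
  assumes "bounded_linear B"
  shows "norm ((B ^^ k) v) \<le> onorm B ^ k * norm v"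
proof (induction k)
  case (Suc k)
  have "norm ((B ^^ Suc k) v) \<le> onorm B * norm ((B ^^ k) v)"
    using onorm[OF assms, of "(B ^^ k) v"] by simp
  also have "\<dots> \<le> onorm B * (onorm B ^ k * norm v)"
    by (intro mult_left_mono Suc onorm_pos_le[OF assms])
  finally show ?case by (simp add: mult.assoc)
qed simp

text \<open>Weakening \<open>(2k+2)!\<close> to \<open>k!\<close> compares the series with an exponential series while keeping the
  factor \<open>s\<^sup>2\<close>, which makes \<open>cosh_tail B s\<close> a small perturbation for small \<open>s\<close>.\<close>

lemma norm_cosh_tail_term_le:
  fixes B :: "'a::real_normed_vector \<Rightarrow> 'a"
  assumes "bounded_linear B"
  shows "norm ((s ^ (2 * k + 2) / fact (2 * k + 2)) *\<^sub>R (B ^^ k) v)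
           \<le> s\<^sup>2 * norm v * (inverse (fact k) * (s\<^sup>2 * onorm B) ^ k)"
proof -
  have "norm ((s ^ (2 * k + 2) / fact (2 * k + 2)) *\<^sub>R (B ^^ k) v)
      = s ^ (2 * k + 2) * inverse (fact (2 * k + 2)) * norm ((B ^^ k) v)"
    by (simp add: divide_inverse abs_mult zero_le_even_power del: power_Suc fact_Suc power_add)
  also have "\<dots> \<le> s ^ (2 * k + 2) * inverse (fact k) * (onorm B ^ k * norm v)"
  proof -
    have "0 \<le> s ^ (2 * k + 2)" by (simp add: zero_le_even_power del: power_Suc power_add)
    moreover have "inverse (fact (2 * k + 2)) \<le> (inverse (fact k) :: real)"
      by (intro le_imp_inverse_le fact_mono) auto
    ultimately show ?thesis
      by (intro mult_mono norm_funpow_le[OF assms] mult_nonneg_nonneg) auto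
  qed
  also have "\<dots> = s\<^sup>2 * norm v * (inverse (fact k) * (s\<^sup>2 * onorm B) ^ k)"
  proof -
    have "s ^ (2 * k + 2) = s\<^sup>2 * (s\<^sup>2) ^ k"
      by (metis power_add power_mult mult.commute)
    then show ?thesis by (simp only: power_mult_distrib mult_ac)
  qed
  finally show ?thesis .
qed

lemma summable_cosh_tail:
  fixes B :: "'a::banach \<Rightarrow> 'a"
  assumes "bounded_linear B"
  shows "summable (\<lambda>k. (s ^ (2 * k + 2) / fact (2 * k + 2)) *\<^sub>R (B ^^ k) v)"
  by (rule summable_comparison_test'[where N = 0, OF summable_mult[OF summable_exp]])
    (rule norm_cosh_tail_term_le[OF assms])

lemma norm_cosh_tail_le:
  fixes B :: "'a::banach \<Rightarrow> 'a"
  assumes "bounded_linear B"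
  shows "norm (cosh_tail B s v) \<le> s\<^sup>2 * exp (s\<^sup>2 * onorm B) * norm v"
proof -
  have "norm (cosh_tail B s v) \<le> (\<Sum>k. s\<^sup>2 * norm v * (inverse (fact k) * (s\<^sup>2 * onorm B) ^ k))"
    unfolding cosh_tail_def
    by (rule norm_suminf_le[OF norm_cosh_tail_term_le[OF assms] summable_mult[OF summable_exp]])
  also have "\<dots> = s\<^sup>2 * norm v * exp (s\<^sup>2 * onorm B)"
    by (subst suminf_mult[OF summable_exp]) (simp add: exp_def divide_inverse)
  finally show ?thesis by (simp add: mult_ac)
qed

lemma linear_cosh_tail:
  fixes B :: "'a::banach \<Rightarrow> 'a"
  assumes B: "bounded_linear B"
  shows "linear (cosh_tail B s)"
proof (rule linearI)
  have lin: "linear (B ^^ k)" for k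
  proof (induction k)
    case 0
    show ?case by (simp add: linear_ident)
  next
    case (Suc k)
    show ?case using linear_compose[OF Suc bounded_linear.linear[OF B]] by (simp add: o_def)
  qed
  show "cosh_tail B s (u + v) = cosh_tail B s u + cosh_tail B s v" for u v
    unfolding cosh_tail_def
    by (simp only: linear_add[OF lin] scaleR_add_right
        suminf_add[OF summable_cosh_tail[OF B] summable_cosh_tail[OF B]])
  show "cosh_tail B s (r *\<^sub>R v) = r *\<^sub>R cosh_tail B s v" for r v
    unfolding cosh_tail_def
    by (simp only: suminf_scaleR_right[OF summable_cosh_tail[OF B]] linear_scale[OF lin]
        scaleR_left_commute)
qed

text \<open>The remainders \<open>R N\<close> of the partial sums satisfy \<open>R (N + 1)'' = B (R N)\<close> and vanish to first order at
  \<open>0\<close>. Starting from a bound \<open>M\<close> for \<open>f\<close> on the interval, integrating twice per step gives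
  \<open>norm (R N x) \<le> M (onorm B)\<^sup>N x\<^bsup>2N\<^esup> / (2N)!\<close>, which tends to \<open>0\<close>.\<close>

lemma ode2_zero_initial_value_solution:
  fixes B :: "'a::banach \<Rightarrow> 'a"
  assumes B: "bounded_linear B"
    and f: "\<And>x. (f has_vector_derivative f' x) (at x)"
    and f': "\<And>x. (f' has_vector_derivative B (f x) + w) (at x)"
    and zero: "f 0 = 0" "f' 0 = 0"
    and s: "0 \<le> s"
  shows "f s = cosh_tail B s w"
proof -
  let ?p = "\<lambda>m x. x ^ m / fact m :: real"
  define R where "R N x = f x - (\<Sum>k<N. ?p (2 * k + 2) x *\<^sub>R (B ^^ k) w)" for N x
  define R' where "R' N x = f' x - (\<Sum>k<N. ?p (2 * k + 1) x *\<^sub>R (B ^^ k) w)" for N x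
  have "continuous_on {0..s} f"
    by (rule continuous_on_vector_derivative)
      (use f has_vector_derivative_at_within in blast)
  then have "bounded (f ` {0..s})"
    by (intro compact_imp_bounded compact_continuous_image) auto
  then obtain M where M: "\<And>x. 0 \<le> x \<Longrightarrow> x \<le> s \<Longrightarrow> norm (f x) \<le> M"
    unfolding bounded_iff by force
  have p: "((\<lambda>x. ?p (Suc m) x *\<^sub>R v) has_vector_derivative ?p m x *\<^sub>R v) (at x)" for m x and v :: 'a
  proof -
    have "(?p (Suc m) has_real_derivative ?p m x) (at x)"
      by (rule derivative_eq_intros refl | simp add: field_simps del: of_nat_Suc)+
    from has_vector_derivative_scaleR[OF this has_vector_derivative_const[of v]]
    show ?thesis by simp
  qed
  have R: "(R N has_vector_derivative R' N x) (at x)" for N x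
    (* p for m = 2k + 1: the summands of R N differentiate to those of R' N. *)
    unfolding R_def R'_def using p[of "Suc (2 * _)"]
    by (intro has_vector_derivative_diff f has_vector_derivative_sum) simp
  have R': "(R' (Suc N) has_vector_derivative B (R N x)) (at x)" for N x
  proof -
    have "(R' (Suc N) has_vector_derivative
        B (f x) + w - (\<Sum>k<Suc N. ?p (2 * k) x *\<^sub>R (B ^^ k) w)) (at x)"
      unfolding R'_def using p[of "2 * _"]
      by (intro has_vector_derivative_diff f' has_vector_derivative_sum) simp
    (* The summand k = 0 is w and cancels; the others are B applied to the summands of R N. *)
    also have "B (f x) + w - (\<Sum>k<Suc N. ?p (2 * k) x *\<^sub>R (B ^^ k) w) = B (R N x)"
      unfolding R_def sum.lessThan_Suc_shift
      by (simp add: linear_diff[OF bounded_linear.linear[OF B]] linear_sum[OF bounded_linear.linear[OF B]]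
          linear_scale[OF bounded_linear.linear[OF B]] del: power_Suc fact_Suc)
    finally show ?thesis .
  qed
  have bound: "norm (R N x) \<le> (M * onorm B ^ N) * x ^ (2 * N) / fact (2 * N)" if "0 \<le> x" "x \<le> s" for N x
    using that
  proof (induction N arbitrary: x)
    case 0
    then show ?case by (simp add: R_def M)
  next
    case (Suc N)
    have "norm (B (R N y)) \<le> (M * onorm B ^ Suc N) * y ^ (2 * N) / fact (2 * N)"
      if "0 \<le> y" "y \<le> s" for y
    proof -
      have "norm (B (R N y)) \<le> onorm B * norm (R N y)" by (rule onorm[OF B])
      also have "\<dots> \<le> onorm B * ((M * onorm B ^ N) * y ^ (2 * N) / fact (2 * N))"
        by (intro mult_left_mono Suc.IH that onorm_pos_le[OF B])
      finally show ?thesis by (simp add: mult_ac)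
    qed
    from norm_le_power_of_second_derivative_bound[OF R R' _ _ this Suc.prems]
    show ?case by (simp add: R_def R'_def zero)
  qed
  have "0 \<le> M" using M[of 0] s zero by simp
  have "(\<lambda>N. R N s) \<longlonglongrightarrow> 0"
  proof (rule Lim_null_comparison)
    have "norm (R N s) \<le> M * (inverse (fact N) * (onorm B * s\<^sup>2) ^ N)" for N
    proof -
      have "norm (R N s) \<le> M * (inverse (fact (2 * N)) * (onorm B * s\<^sup>2) ^ N)"
        using bound[of s N] s
        by (simp add: divide_inverse power_mult_distrib power_mult[symmetric] mult_ac)
      also have "\<dots> \<le> M * (inverse (fact N) * (onorm B * s\<^sup>2) ^ N)"
        using \<open>0 \<le> M\<close> onorm_pos_le[OF B]
        by (intro mult_left_mono mult_right_mono le_imp_inverse_le fact_mono) auto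
      finally show ?thesis .
    qed
    then show "\<forall>\<^sub>F N in sequentially. norm (R N s) \<le> M * (inverse (fact N) * (onorm B * s\<^sup>2) ^ N)"
      by simp
    show "(\<lambda>N. M * (inverse (fact N) * (onorm B * s\<^sup>2) ^ N)) \<longlonglongrightarrow> 0"
      by (intro tendsto_mult_right_zero summable_LIMSEQ_zero summable_exp)
  qed
  from tendsto_diff[OF tendsto_const[of "f s"] this]
  have "(\<lambda>k. ?p (2 * k + 2) s *\<^sub>R (B ^^ k) w) sums f s"
    by (simp add: sums_def R_def)
  then show ?thesis unfolding cosh_tail_def by (rule sums_unique)
qed

section \<open>Affine invariance of the solutions\<close>

text \<open>The derivative of order \<open>k + 2\<close> is an affine image of the one of order \<open>k\<close>. The constant \<open>e\<close> is \<open>d\<close>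
  for \<open>k = 0\<close> and \<open>0\<close> afterwards; leaving it existential makes the induction uniform.\<close>

lemma solves_ode2_imp_smooth:
  assumes "solves_ode2 B d c"
  shows "smooth_curve c"
proof -
  have "\<exists>e. \<forall>t. iter_vderiv k c differentiable (at t) \<and>
      (iter_vderiv (Suc k) c has_vector_derivative B *v iter_vderiv k c t + e) (at t)" for k
  proof (induction k)
    case 0
    have "iter_vderiv (Suc 0) c = (\<lambda>u. vector_derivative c (at u))"
      by (simp add: fun_eq_iff iter_vderiv_Suc iter_vderiv_0)
    then show ?case using assms unfolding solves_ode2_def iter_vderiv_0 by auto
  next
    case (Suc k)
    then obtain e where e: "\<And>t. iter_vderiv k c differentiable (at t)"
      "\<And>t. (iter_vderiv (Suc k) c has_vector_derivative B *v iter_vderiv k c t + e) (at t)" by blast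
    have eq: "iter_vderiv (Suc (Suc k)) c = (\<lambda>t. B *v iter_vderiv k c t + e)"
      using vector_derivative_at[OF e(2)] by (simp add: fun_eq_iff iter_vderiv_Suc[of "Suc k"])
    have "(iter_vderiv k c has_vector_derivative iter_vderiv (Suc k) c t) (at t)" for t
      using e(1) by (simp add: iter_vderiv_Suc vector_derivative_works)
    from has_vector_derivative_add[OF bounded_linear.has_vector_derivative[OF
          matrix_vector_mul_bounded_linear this] has_vector_derivative_const]
    have "(iter_vderiv (Suc (Suc k)) c has_vector_derivative B *v iter_vderiv (Suc k) c t + 0) (at t)" for t
      unfolding eq .
    then show ?case using e(2) differentiableI_vector by blast
  qed
  then show ?thesis unfolding smooth_curve_def by blast
qed

lemma solves_ode2_imp_affinely_invariant:
  fixes B :: "real^'n^'n"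
  assumes ode: "solves_ode2 B d c"
  shows "affinely_invariant c"
proof -
  let ?B = "(*v) B"
  have B: "bounded_linear ?B" by (rule matrix_vector_mul_bounded_linear)
  let ?S = "cosh_tail ?B"
  define A :: "real \<Rightarrow> real^'n^'n" where "A s = matrix (\<lambda>v. v + (1/2) *\<^sub>R ?S s (B *v v))" for s
  define b where "b s = (1/2) *\<^sub>R ?S s d" for s
  have A: "A s *v v = v + (1/2) *\<^sub>R ?S s (B *v v)" for s v
  proof -
    have "linear (\<lambda>v. v + (1/2) *\<^sub>R ?S s (B *v v))"
      by (intro linear_compose_add linear_compose_scale_right linear_ident
          linear_compose[OF matrix_vector_mul_linear linear_cosh_tail[OF B], unfolded o_def])
    then show ?thesis unfolding A_def by (simp add: matrix_works)
  qed
  (* An upper bound for the operator norm of S s B / 2. *)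
  define g where "g s = (1/2) * (s\<^sup>2 * exp (s\<^sup>2 * onorm ?B) * onorm ?B)" for s :: real
  have "(g \<longlongrightarrow> (1/2) * (0\<^sup>2 * exp (0\<^sup>2 * onorm ?B) * onorm ?B)) (at 0)"
    unfolding g_def by (intro tendsto_intros)
  then have "\<forall>\<^sub>F s in at 0. g s < 1" by (rule order_tendstoD) simp
  then obtain \<epsilon> where \<epsilon>: "\<epsilon> > 0" "\<And>s. s \<noteq> 0 \<Longrightarrow> dist s 0 < \<epsilon> \<Longrightarrow> g s < 1"
    unfolding eventually_at by auto
  have inv: "invertible (A s)" if "s \<in> {-\<epsilon><..<\<epsilon>}" for s
  proof -
    have g1: "g s < 1" using \<epsilon>(2)[of s] that by (cases "s = 0") (auto simp: g_def dist_real_def)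
    (* A kernel vector v satisfies v = - S s (B v) / 2, of norm at most g s * norm v. *)
    have "v = 0" if "A s *v v = 0" for v
    proof (rule ccontr)
      assume "v \<noteq> 0"
      have "v = - ((1/2) *\<^sub>R ?S s (B *v v))" using that unfolding A by (simp add: eq_neg_iff_add_eq_0)
      then have "norm v = (1/2) * norm (?S s (B *v v))" by (metis norm_minus_cancel norm_scaleR abs_of_pos half_gt_zero_iff zero_less_one)
      also have "\<dots> \<le> (1/2) * (s\<^sup>2 * exp (s\<^sup>2 * onorm ?B) * (onorm ?B * norm v))"
        by (intro mult_left_mono order_trans[OF norm_cosh_tail_le[OF B]] onorm[OF B]) auto
      also have "\<dots> = g s * norm v" by (simp add: g_def)
      also have "\<dots> < norm v" using g1 \<open>v \<noteq> 0\<close> by simp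
      finally show False by simp
    qed
    then show ?thesis
      using invertible_left_inverse matrix_left_invertible_ker by blast
  qed
  have T: "T_curve s c t = A s *v c t + b s" if "s \<in> {0<..<\<epsilon>}" for s t
  proof -
    let ?c' = "\<lambda>u. vector_derivative c (at u)" and ?c'' = "\<lambda>u. B *v c u + d"
    have c': "(c has_vector_derivative ?c' u) (at u)" and c'': "(?c' has_vector_derivative ?c'' u) (at u)" for u
      using ode unfolding solves_ode2_def by (simp_all add: vector_derivative_works)
    let ?f = "\<lambda>s. c (t + s) + c (t - s) - 2 *\<^sub>R c t"
    have "?f s = ?S s (2 *\<^sub>R ?c'' t)"
    proof (rule ode2_zero_initial_value_solution[OF B])
      show "(?f has_vector_derivative ?c' (t + x) - ?c' (t - x)) (at x)" for x
        by (rule second_difference_has_vector_derivatives(1)[OF c' c''])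
      have "?c'' (t + x) + ?c'' (t - x) = B *v ?f x + 2 *\<^sub>R ?c'' t" for x
        unfolding matrix_vector_right_distrib matrix_vector_mult_diff_distrib
          matrix_vector_mult_scaleR by (simp add: scaleR_2)
      then show "((\<lambda>x. ?c' (t + x) - ?c' (t - x)) has_vector_derivative B *v ?f x + 2 *\<^sub>R ?c'' t) (at x)" for x
        using second_difference_has_vector_derivatives(2)[OF c' c'', of t x] by simp
    qed (use that in \<open>auto simp: scaleR_2\<close>)
    also have "\<dots> = 2 *\<^sub>R (?S s (B *v c t) + ?S s d)"
      using linear_cosh_tail[OF B] by (simp add: linear_scale linear_add)
    finally have f: "?f s = 2 *\<^sub>R (?S s (B *v c t) + ?S s d)" .
    have "T_curve s c t = c t + (1/4) *\<^sub>R ?f s"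
      by (simp add: T_curve_def vec_eq_iff field_simps)
    then show ?thesis unfolding f A b_def by (simp add: algebra_simps)
  qed
  show ?thesis unfolding affinely_invariant_def using \<epsilon>(1) inv T by blast
qed

theorem theorem2:
  shows "(\<forall>c :: real \<Rightarrow> real^'n. \<forall>t\<^sub>0.
            smooth_curve c \<longrightarrow> affinely_invariant c \<longrightarrow>
            independent_family_on {1..CARD('n)} (\<lambda>k. iter_vderiv k c t\<^sub>0) \<longrightarrow>
            (\<exists>!p :: (real^'n^'n) \<times> (real^'n).
               \<forall>t. iter_vderiv 2 c t = fst p *v c t + snd p)) \<and>
         (\<forall>(B :: real^'n^'n) (d :: real^'n) (c :: real \<Rightarrow> real^'n).
            solves_ode2 B d c \<longrightarrow> smooth_curve c \<and> affinely_invariant c)"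
proof (intro conjI allI impI)
  fix c :: "real \<Rightarrow> real^'n" and t\<^sub>0
  assume smooth: "smooth_curve c" and inv: "affinely_invariant c"
    and indep: "independent_family_on {1..CARD('n)} (\<lambda>k. iter_vderiv k c t\<^sub>0)"
  obtain B :: "real^'n^'n" and d where Bd: "\<And>t. iter_vderiv 2 c t = B *v c t + d"
    using affinely_invariant_imp_ode2[OF smooth inv indep] by blast
  show "\<exists>!p :: (real^'n^'n) \<times> (real^'n). \<forall>t. iter_vderiv 2 c t = fst p *v c t + snd p"
  proof (rule ex1I[of _ "(B, d)"])
    show "\<forall>t. iter_vderiv 2 c t = fst (B, d) *v c t + snd (B, d)" using Bd by simp
    fix p :: "(real^'n^'n) \<times> (real^'n)"
    assume "\<forall>t. iter_vderiv 2 c t = fst p *v c t + snd p"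
    then have "fst p *v c t + snd p = B *v c t + d" for t using Bd by metis
    from ode2_coefficients_unique[OF smooth indep this] show "p = (B, d)"
      by (simp add: prod_eq_iff)
  qed
next
  fix B :: "real^'n^'n" and d c
  assume "solves_ode2 B d c"
  then show "smooth_curve c" and "affinely_invariant c"
    by (rule solves_ode2_imp_smooth, rule solves_ode2_imp_affinely_invariant)
qed

end
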